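(* Let $\xi=(\xi_t,t\ge 0)$ be a real-valued Lévy process killed at an independent exponential time $\zeta$ of parameter $q\ge 0$, where for $q=0$ we have $\zeta=\infty$ and assume $\lim_{t\to\infty}\xi_t=-\infty$ almost surely. Let $U(dy)$ be the renewal measure of $\xi$ and let $k$ be the probability density function of the exponential functional $I=\int_0^\zeta e^{\xi_s}\,ds$. Then $$\int_t^\infty k(s)\,ds=\int_{\mathbb{R}}U(dy)\,k(te^{-y}),\qquad\text{for a.e. } t\in(0,\infty).$$
   Context: After killing, $\xi_t=-\infty$ for $t\ge\zeta$ (with $e^{-\infty}=0$), so $I=\int_0^\zeta e^{\xi_s}ds=\int_0^\infty e^{\xi_s}ds$, which is finite almost surely under the stated assumptions. The law of $I$ is taken to admit a density with respect to Lebesgue measure on $(0,\infty)$; this is a standing fact recalled from the literature. The renewal (potential) measure of $\xi$ is the $\sigma$-finite measure on $\mathbb{R}$ given by $U(dy)=\mathbb{E}\left(\int_0^\zeta 1_{\{\xi_t\in dy\}}\,dt\right)$. *)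

theory Defs
  imports "HOL-Probability.Probability"
begin

definition cadlag :: "(real \<Rightarrow> real) \<Rightarrow> bool" where
  "cadlag x \<longleftrightarrow>
     (\<forall>t\<ge>0. continuous (at_right t) x) \<and> (\<forall>t>0. \<exists>l. (x \<longlongrightarrow> l) (at_left t))"

text \<open>
  Real-valued Levy processes. Time is \<open>[0,\<infinity>)\<close>; the values of \<open>X\<close> at negative times are irrelevant.
\<close>

locale levy_process = prob_space M for M :: "'a measure" +
  fixes X :: "real \<Rightarrow> 'a \<Rightarrow> real"
  assumes random_variable_X: "\<And>t. 0 \<le> t \<Longrightarrow> random_variable borel (X t)"
    and start_0: "AE \<omega> in M. X 0 \<omega> = 0"
    and independent_increments:
      "\<And>(t :: nat \<Rightarrow> real) n. 0 \<le> t 0 \<Longrightarrow> incseq t \<Longrightarrow>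
         indep_vars (\<lambda>_. borel) (\<lambda>i \<omega>. X (t (Suc i)) \<omega> - X (t i) \<omega>) {..<n}"
    and stationary_increments:
      "\<And>s t. 0 \<le> s \<Longrightarrow> 0 \<le> t \<Longrightarrow>
         distr M borel (\<lambda>\<omega>. X (s + t) \<omega> - X s \<omega>) = distr M borel (X t)"
    and cadlag_paths: "AE \<omega> in M. cadlag (\<lambda>t. X t \<omega>)"

text \<open>
  A Levy process \<open>\<eta>\<close> together with a killing time \<open>\<zeta>\<close>, exponentially distributed with
  parameter \<open>q\<close> and independent of the whole process \<open>\<eta>\<close> (the pullback of the product \<open>\<sigma>\<close>-algebra
  along the path map is \<open>\<sigma>(\<eta>\<^sub>t, t \<ge> 0)\<close>). For \<open>q = 0\<close> there is no killing. Here \<open>\<eta>\<close> is the process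
  before killing; the killed process is \<open>killed \<eta> \<zeta>\<close> below.
\<close>

locale killed_levy_process = levy_process M \<eta>
  for M :: "'a measure" and \<eta> :: "real \<Rightarrow> 'a \<Rightarrow> real" +
  fixes \<zeta> :: "'a \<Rightarrow> ennreal" and q :: real
  assumes rate_nonneg: "0 \<le> q"
    and random_variable_killing_time: "random_variable borel \<zeta>"
    and killing_time_exponential:
      "0 < q \<Longrightarrow> distr M borel \<zeta> = distr (density lborel (exponential_density q)) borel ennreal"
    and no_killing: "q = 0 \<Longrightarrow> AE \<omega> in M. \<zeta> \<omega> = \<infinity>"
    and killing_time_independent:
      "indep_set
         (sets (vimage_algebra (space M) (\<lambda>\<omega>. \<lambda>t\<in>{0..}. \<eta> t \<omega>) (\<Pi>\<^sub>M t\<in>{0..}. borel)))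
         (sets (vimage_algebra (space M) \<zeta> borel))"

definition killed :: "(real \<Rightarrow> 'a \<Rightarrow> real) \<Rightarrow> ('a \<Rightarrow> ennreal) \<Rightarrow> real \<Rightarrow> 'a \<Rightarrow> ereal" where
  "killed \<eta> \<zeta> t \<omega> = (if ennreal t < \<zeta> \<omega> then ereal (\<eta> t \<omega>) else - \<infinity>)"

definition exp_ereal :: "ereal \<Rightarrow> ennreal" where
  "exp_ereal x =
     (if x = - \<infinity> then 0 else if x = \<infinity> then \<infinity> else ennreal (exp (real_of_ereal x)))"

definition lifetime :: "('a \<Rightarrow> ennreal) \<Rightarrow> 'a \<Rightarrow> real set" where
  "lifetime \<zeta> \<omega> = {t. 0 \<le> t \<and> ennreal t < \<zeta> \<omega>}"

text \<open>
  In the next two definitions \<open>\<xi>\<close> is the killed process and \<open>\<zeta>\<close> its killing time; integrals over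
  \<open>lifetime \<zeta> \<omega>\<close> are the integrals from \<open>0\<close> to \<open>\<zeta>\<close>.
\<close>

definition exponential_functional ::
    "(real \<Rightarrow> 'a \<Rightarrow> ereal) \<Rightarrow> ('a \<Rightarrow> ennreal) \<Rightarrow> 'a \<Rightarrow> ennreal" where
  "exponential_functional \<xi> \<zeta> \<omega> = (\<integral>\<^sup>+s\<in>lifetime \<zeta> \<omega>. exp_ereal (\<xi> s \<omega>) \<partial>lborel)"

definition renewal_measure ::
    "'a measure \<Rightarrow> (real \<Rightarrow> 'a \<Rightarrow> ereal) \<Rightarrow> ('a \<Rightarrow> ennreal) \<Rightarrow> real measure" where
  "renewal_measure M \<xi> \<zeta> = measure_of UNIV (sets borel)
     (\<lambda>B. \<integral>\<^sup>+\<omega>. (\<integral>\<^sup>+t\<in>lifetime \<zeta> \<omega>. indicator (ereal ` B) (\<xi> t \<omega>) \<partial>lborel) \<partial>M)"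

text \<open>
  \<open>k\<close> is a density of the law of \<open>I\<close> on \<open>(0,\<infinity>)\<close>. Since \<open>enn2real \<infinity> = 0\<close> and a law with a density has
  no atom at \<open>0\<close>, the condition includes that \<open>I\<close> is finite (and positive) almost surely; \<open>k\<close> then
  vanishes almost everywhere on \<open>(-\<infinity>,0]\<close>.
\<close>

definition has_probability_density :: "'a measure \<Rightarrow> ('a \<Rightarrow> ennreal) \<Rightarrow> (real \<Rightarrow> real) \<Rightarrow> bool" where
  "has_probability_density M I k \<longleftrightarrow>
     (\<forall>x. 0 \<le> k x) \<and> distributed M lborel (\<lambda>\<omega>. enn2real (I \<omega>)) (\<lambda>x. ennreal (k x))"

end

theory Submission
  imports Defs
begin

text \<open>
  The idea is to compute the truncated mean \<open>E (min I a)\<close> in two ways, for every \<open>a > 0\<close>.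
  By Fubini it is \<open>\<integral>\<^sub>0\<^sup>a P(I > t) dt\<close>, the integral over \<open>(0, a]\<close> of the left-hand side of the claim.

  For the second computation, let \<open>R\<^sub>s = \<integral>\<^sub>s\<^sup>\<zeta> exp \<xi>\<^sub>u du\<close> be the part of the functional that is still to come
  at time \<open>s\<close>. Along a fixed path it decreases continuously from \<open>I\<close> to \<open>0\<close> with speed \<open>exp \<xi>\<^sub>s\<close>, so
  the substitution \<open>v = R\<^sub>s\<close> gives \<open>min I a = \<integral>\<^sub>0\<^sup>\<zeta> exp \<xi>\<^sub>s 1{R\<^sub>s \<le> a} ds\<close>
  (\<open>nn_integral_tail_le\<close>). On \<open>{s < \<zeta>}\<close> we have \<open>R\<^sub>s = exp \<xi>\<^sub>s \<cdot> I'\<close>, where \<open>I'\<close> is the functional of the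
  process restarted at time \<open>s\<close> (\<open>tail_path_functional\<close>). By the simple Markov property and the lack
  of memory of \<open>\<zeta>\<close>, on that event \<open>I'\<close> is independent of \<open>\<xi>\<^sub>s\<close> and has the law of \<open>I\<close>
  (\<open>markov_property_on_survival\<close>). Conditioning on \<open>\<xi>\<^sub>s = y\<close> therefore turns the integrand into
  \<open>exp y P(exp y I \<le> a) = \<integral>\<^sub>0\<^sup>a k(v exp (-y)) dv\<close>, and integrating over \<open>s\<close> and \<open>\<omega>\<close> produces the renewal
  measure: \<open>E (min I a) = \<integral>\<^sub>0\<^sup>a \<integral> k(v exp (-y)) U(dy) dv\<close>.

  As \<open>E (min I a) \<le> a\<close> is finite and \<open>a\<close> is arbitrary, the two integrands agree almost everywhere.

  The measure-theoretic obstacle is that functionals of a whole path are not measurable for the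
  product \<open>\<sigma>\<close>-algebra on paths, in terms of which both the independence of \<open>\<zeta>\<close> and the law of the
  process are expressed. It is overcome by reading off the value of a path at \<open>u\<close> as a limit along
  rational times to the right of \<open>u\<close>: this \<open>right_value\<close> is jointly measurable in the path and in
  \<open>u\<close>, and for right-continuous paths and \<open>u \<ge> 0\<close> it is the value itself.
\<close>

section \<open>Integrals and densities on the real line\<close>

text \<open>
  The probability integral transform: without atoms the tail \<open>s \<mapsto> \<mu>[s, \<infinity>)\<close> is continuous, so unless
  the total mass is at most \<open>a\<close> it attains the value \<open>a\<close>. The set in question is then \<open>[s\<^sub>0, \<infinity>)\<close>
  with \<open>s\<^sub>0\<close> the first point where the tail equals \<open>a\<close>, and has mass \<open>a\<close>.
\<close>

lemma (in finite_borel_measure) emeasure_tail_le: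
  assumes atomless: "\<And>x. measure M {x} = 0" and "0 < a"
  shows "emeasure M {s. emeasure M {s..} \<le> ennreal a} = min (emeasure M UNIV) (ennreal a)"
proof -
  define m where "m = measure M UNIV"
  have UNIV: "space M = UNIV"
    by (rule borel_UNIV)
  have tail: "measure M {s..} = m - cdf M s" for s
  proof -
    have "measure M {s..} = measure M ({s} \<union> {s<..})"
      by (intro arg_cong[where f = "measure M"]) auto
    also have "\<dots> = measure M {s} + measure M {s<..}"
      by (intro finite_measure_Union) auto
    also have "{s<..} = UNIV - {..s}"
      by auto
    also have "measure M \<dots> = m - cdf M s"
      unfolding m_def cdf_def using finite_measure_compl[of "{..s}"] by (simp add: UNIV M_is_borel)
    finally show ?thesis
      by (simp add: atomless)
  qed
  have cont: "continuous_on UNIV (cdf M)"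
    using isCont_cdf atomless by (simp add: continuous_on_eq_continuous_at)
  define S where "S = {s. m - a \<le> cdf M s}"
  have S: "{s. emeasure M {s..} \<le> ennreal a} = S"
    using \<open>0 < a\<close> by (auto simp: S_def emeasure_eq_measure tail ennreal_le_iff)
  show ?thesis
  proof (cases "m \<le> a")
    case True
    then have "S = UNIV"
      using cdf_nonneg by (auto simp: S_def intro: order_trans[of _ 0])
    then show ?thesis
      unfolding S using True by (simp add: emeasure_eq_measure m_def[symmetric] min_def ennreal_leI)
  next
    case False
    have "\<forall>\<^sub>F s in at_bot. cdf M s < m - a"
      using cdf_lim_at_bot False by (intro order_tendstoD) auto
    then obtain l where l: "\<And>s. s \<le> l \<Longrightarrow> cdf M s < m - a"
      by (auto simp: eventually_at_bot_linorder)
    have "\<forall>\<^sub>F s in at_top. m - a < cdf M s"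
      using cdf_lim_at_top \<open>0 < a\<close> by (intro order_tendstoD[where y = m]) (auto simp: m_def UNIV)
    then obtain u where u: "\<And>s. u \<le> s \<Longrightarrow> m - a < cdf M s"
      by (auto simp: eventually_at_top_linorder)
    have "l \<le> u"
      using l[of l] u[of l] by linarith
    then obtain s1 where s1: "cdf M s1 = m - a"
      using IVT'[of "cdf M" l "m - a" u] l[of l] u[of u] continuous_on_subset[OF cont] by auto
    have bdd: "bdd_below S"
      by (intro bdd_belowI[of _ l]) (use l in \<open>force simp: S_def not_less[symmetric]\<close>)
    have "closed S"
      unfolding S_def by (intro closed_Collect_le cont continuous_on_const)
    moreover have "s1 \<in> S"
      by (simp add: S_def s1)
    ultimately have Inf: "Inf S \<in> S"
      using bdd by (intro closed_contains_Inf) auto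
    have "cdf M (Inf S) \<le> m - a"
      using cdf_nondecreasing[OF cInf_lower[OF \<open>s1 \<in> S\<close> bdd]] s1 by simp
    with Inf have eq: "cdf M (Inf S) = m - a"
      by (simp add: S_def)
    have "S = {Inf S..}"
      using Inf cInf_lower[OF _ bdd] cdf_nondecreasing by (force simp: S_def)
    then have "measure M S = m - cdf M (Inf S)"
      using tail by metis
    then show ?thesis
      unfolding S using False \<open>0 < a\<close> by (simp add: eq emeasure_eq_measure m_def[symmetric] min_def)
  qed
qed

text \<open>
  This is the substitution \<open>v = \<integral>\<^sub>s\<^sup>\<infinity> f\<close>, obtained without differentiating the tail integral:
  \<open>emeasure_tail_le\<close> is applied to the measure with density \<open>f\<close>.
\<close>

lemma nn_integral_tail_le:
  fixes f :: "real \<Rightarrow> ennreal"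
  assumes [measurable]: "f \<in> borel_measurable borel"
    and fin: "(\<integral>\<^sup>+u. f u \<partial>lborel) < \<infinity>" and "0 < a"
  shows "(\<integral>\<^sup>+s. f s * indicator {..ennreal a} (\<integral>\<^sup>+u. f u * indicator {s..} u \<partial>lborel) \<partial>lborel) =
    min (\<integral>\<^sup>+u. f u \<partial>lborel) (ennreal a)"
proof -
  let ?N = "density lborel f"
  have e: "emeasure ?N B = (\<integral>\<^sup>+u. f u * indicator B u \<partial>lborel)" if "B \<in> sets borel" for B
    using that by (simp add: emeasure_density)
  interpret finite_measure ?N
    using fin by (intro finite_measureI) (simp add: emeasure_density)
  interpret finite_borel_measure ?N
    by standard simp
  have [measurable]: "(\<lambda>s. \<integral>\<^sup>+u. f u * indicator {s..} u \<partial>lborel) \<in> borel_measurable borel"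
  proof -
    have "(\<lambda>(s, u). f u * indicator {s..} u) \<in> borel_measurable (borel \<Otimes>\<^sub>M lborel)"
      by (subst measurable_cong[where g = "\<lambda>(s, u). f u * of_bool (s \<le> u)"])
        (auto simp: indicator_def split: prod.splits)
    then show ?thesis
      by (rule lborel.borel_measurable_nn_integral)
  qed
  have "measure ?N {x} = 0" for x
  proof -
    have "emeasure ?N {x} = 0"
      using absolutely_continuousI_density[of f lborel]
      by (auto simp: absolutely_continuous_def null_sets_def subset_iff)
    then show ?thesis by (simp add: measure_def)
  qed
  from emeasure_tail_le[OF this \<open>0 < a\<close>] show ?thesis
    by (simp add: e indicator_def)
qed

lemma nn_integral_indicator_below:
  assumes "0 < a"
  shows "(\<integral>\<^sup>+v. of_bool (0 < v \<and> v \<le> a \<and> ennreal v < r) \<partial>lborel) = min r (ennreal a)"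
proof -
  have "(\<integral>\<^sup>+v. of_bool (0 < v \<and> v \<le> a \<and> ennreal v < r) \<partial>lborel) =
      (\<integral>\<^sup>+v. indicator {v. 0 < v \<and> v \<le> a \<and> ennreal v < r} v \<partial>lborel)"
    by (intro nn_integral_cong) (auto simp: indicator_def)
  also have "\<dots> = emeasure lborel {v. 0 < v \<and> v \<le> a \<and> ennreal v < r}"
    by (rule nn_integral_indicator) measurable
  also have "\<dots> = min r (ennreal a)"
  proof (cases r)
    case (real x)
    then have "{v. 0 < v \<and> v \<le> a \<and> ennreal v < r} = (if x \<le> a then {0<..<x} else {0<..a})"
      using \<open>0 < a\<close> by (auto simp: ennreal_less_iff)
    then show ?thesis
      using real \<open>0 < a\<close> by (auto simp: min_def ennreal_le_iff)
  next
    case top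
    then have "{v. 0 < v \<and> v \<le> a \<and> ennreal v < r} = {0<..a}"
      by auto
    then show ?thesis
      using top \<open>0 < a\<close> by (simp add: min_def top_unique)
  qed
  finally show ?thesis .
qed

text \<open>
  The half-lines \<open>(-\<infinity>, a]\<close> generate the Borel sets, so the measures with densities \<open>f\<close> and \<open>g\<close> on
  \<open>(0, \<infinity>)\<close> coincide.
\<close>

lemma AE_lborel_eq_if_integrals_atMost_eq:
  fixes f g :: "real \<Rightarrow> ennreal"
  assumes [measurable]: "f \<in> borel_measurable borel" "g \<in> borel_measurable borel"
    and eq: "\<And>a. 0 < a \<Longrightarrow> (\<integral>\<^sup>+t. of_bool (0 < t \<and> t \<le> a) * f t \<partial>lborel) =
      (\<integral>\<^sup>+t. of_bool (0 < t \<and> t \<le> a) * g t \<partial>lborel)"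
    and fin: "\<And>a. 0 < a \<Longrightarrow> (\<integral>\<^sup>+t. of_bool (0 < t \<and> t \<le> a) * f t \<partial>lborel) < \<infinity>"
  shows "AE t in lborel. 0 < t \<longrightarrow> f t = g t"
proof -
  let ?m = "\<lambda>h. density lborel (\<lambda>t. of_bool (0 < t) * h t)"
  have m: "emeasure (?m h) {..a} = (\<integral>\<^sup>+t. of_bool (0 < t \<and> t \<le> a) * h t \<partial>lborel)"
    if [measurable]: "h \<in> borel_measurable borel" for h :: "real \<Rightarrow> ennreal" and a
    by (simp add: emeasure_density) (auto intro!: nn_integral_cong simp: indicator_def)
  have empty: "(\<integral>\<^sup>+t. of_bool (0 < t \<and> t \<le> a) * h t \<partial>lborel) = 0"
    if "a \<le> 0" for h :: "real \<Rightarrow> ennreal" and a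
  proof -
    have "(\<integral>\<^sup>+t. of_bool (0 < t \<and> t \<le> a) * h t \<partial>lborel) = (\<integral>\<^sup>+t. 0 \<partial>(lborel :: real measure))"
      by (intro nn_integral_cong) (use that in auto)
    then show ?thesis by simp
  qed
  have "?m f = ?m g"
  proof (rule measure_eqI_generator_eq)
    show "Int_stable (range (atMost :: real \<Rightarrow> real set))"
      by (auto simp: Int_stable_def)
    show "emeasure (?m f) B = emeasure (?m g) B" if B: "B \<in> range atMost" for B
    proof -
      obtain a where "B = {..a}" using B by auto
      then show ?thesis
        using eq[of a] empty[of a] by (cases "0 < a") (simp_all add: m)
    qed
    show "range (\<lambda>n. {..real n}) \<subseteq> range atMost" "(\<Union>n. {..real n}) = UNIV"
      by (auto intro: real_arch_simple)
    show "emeasure (?m f) {..real n} \<noteq> \<infinity>" for n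
      using fin[of "real n"] empty[of "real n"] by (cases "n = 0") (simp_all add: m less_top)
  qed (simp_all add: borel_eq_atMost)
  then have "AE t in lborel. of_bool (0 < t) * f t = of_bool (0 < t) * g t"
    by (intro sigma_finite_measure.density_unique[OF lborel.sigma_finite_measure_axioms]) measurable
  then show ?thesis
    by eventually_elim auto
qed

section \<open>Evaluating paths measurably\<close>

abbreviation path_space :: "(real \<Rightarrow> real) measure" where
  "path_space \<equiv> \<Pi>\<^sub>M t\<in>{0..}. borel"

text \<open>
  The first point after \<open>u\<close> of the grid of width \<open>1 / (n + 1)\<close>. Truncation by \<open>nat\<close> keeps the grid point
  positive also for \<open>u < 0\<close>, so that it always indexes a coordinate of \<open>path_space\<close>.
\<close>

definition grid_after :: "nat \<Rightarrow> real \<Rightarrow> real" where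
  "grid_after n u = real (Suc (nat \<lfloor>real (Suc n) * u\<rfloor>)) / real (Suc n)"

lemma grid_after_nonneg: "0 \<le> grid_after n u"
  by (simp add: grid_after_def)

lemma grid_after_bounds:
  assumes "0 \<le> u"
  shows "u < grid_after n u" "grid_after n u \<le> u + 1 / real (Suc n)"
proof -
  have "0 \<le> real (Suc n) * u" using assms by simp
  then have *: "real (nat \<lfloor>real (Suc n) * u\<rfloor>) = of_int \<lfloor>real (Suc n) * u\<rfloor>"
    by simp
  have "real (Suc n) * u < real (Suc (nat \<lfloor>real (Suc n) * u\<rfloor>))"
    using floor_correct[of "real (Suc n) * u"] * by linarith
  then show "u < grid_after n u"
    by (simp add: grid_after_def field_simps del: of_nat_Suc)
  have "real (Suc (nat \<lfloor>real (Suc n) * u\<rfloor>)) \<le> real (Suc n) * u + 1"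
    using floor_correct[of "real (Suc n) * u"] * by linarith
  then show "grid_after n u \<le> u + 1 / real (Suc n)"
    by (simp add: grid_after_def field_simps del: of_nat_Suc)
qed

lemma grid_after_tendsto:
  assumes "0 \<le> u"
  shows "filterlim (\<lambda>n. grid_after n u) (at_right u) sequentially"
  unfolding filterlim_at
proof
  show "\<forall>\<^sub>F n in sequentially. grid_after n u \<in> {u<..} \<and> grid_after n u \<noteq> u"
    using grid_after_bounds(1)[OF assms] by (auto intro!: always_eventually simp: less_imp_neq[symmetric])
  have "(\<lambda>n. u + 1 / real (Suc n)) \<longlonglongrightarrow> u + 0"
    by (intro tendsto_intros LIMSEQ_Suc[OF lim_1_over_n])
  then have upper: "(\<lambda>n. u + 1 / real (Suc n)) \<longlonglongrightarrow> u"
    by simp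
  show "(\<lambda>n. grid_after n u) \<longlonglongrightarrow> u"
    by (rule tendsto_sandwich[OF always_eventually always_eventually tendsto_const upper])
      (use grid_after_bounds[OF assms] in \<open>blast intro: less_imp_le\<close>)+
qed

definition right_value :: "(real \<Rightarrow> real) \<Rightarrow> real \<Rightarrow> real" where
  "right_value x u = lim (\<lambda>n. x (grid_after n u))"

lemma right_value_eq:
  assumes "0 \<le> u" "continuous (at_right u) x"
  shows "right_value x u = x u"
  unfolding right_value_def
  using assms grid_after_tendsto[OF assms(1)]
  by (intro limI) (auto simp: continuous_within intro: filterlim_compose)

text \<open>
  The grid points take countably many values, so evaluating at them is jointly measurable although
  evaluation at a real time is not; \<open>right_value\<close> is a limit of such evaluations.
\<close>

lemma right_value_measurable [measurable]:
  "(\<lambda>(x, u). right_value x u) \<in> borel_measurable (path_space \<Otimes>\<^sub>M borel)"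
proof -
  have "(\<lambda>p. fst p (grid_after n (snd p))) \<in> borel_measurable (path_space \<Otimes>\<^sub>M borel)" for n
  proof -
    have "(\<lambda>p. (\<lambda>i p. fst p (real (Suc i) / real (Suc n))) (nat \<lfloor>real (Suc n) * snd p\<rfloor>) p)
        \<in> borel_measurable (path_space \<Otimes>\<^sub>M borel)"
      by (rule measurable_compose_countable) auto
    then show ?thesis by (simp add: grid_after_def)
  qed
  then show ?thesis
    unfolding right_value_def case_prod_beta by (rule borel_measurable_lim_metric)
qed

text \<open>
  The derivative in \<open>u\<close> of \<open>\<integral>\<^sub>0\<^sup>u exp x\<^sub>r dr\<close>, the clock of Lamperti's time change, for a path \<open>x\<close> killed
  at \<open>z\<close>. The exponential functional is the total time \<open>path_functional x z\<close> on this clock.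
\<close>

definition clock_rate :: "(real \<Rightarrow> real) \<Rightarrow> ennreal \<Rightarrow> real \<Rightarrow> ennreal" where
  "clock_rate x z u = ennreal (exp (right_value x u)) * of_bool (0 \<le> u \<and> ennreal u < z)"

definition path_functional :: "(real \<Rightarrow> real) \<Rightarrow> ennreal \<Rightarrow> ennreal" where
  "path_functional x z = (\<integral>\<^sup>+u. clock_rate x z u \<partial>lborel)"

lemma path_functional_measurable [measurable]:
  "(\<lambda>(x, z). path_functional x z) \<in> borel_measurable (path_space \<Otimes>\<^sub>M borel)"
  unfolding path_functional_def clock_rate_def case_prod_beta by measurable

section \<open>Restarting a Levy process at a fixed time\<close>

text \<open>
  A finite set of times as values of an increasing sequence that starts at \<open>0\<close>, the form in which
  independence of increments is available. The sequence is constant once the set is exhausted.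
\<close>

lemma finite_nonneg_set_enum:
  assumes "finite (J :: real set)" "J \<subseteq> {0..}"
  obtains t :: "nat \<Rightarrow> real" and n where "t 0 = 0" "incseq t" "0 < n" "J \<subseteq> t ` {..n}"
proof -
  define L where "L = sorted_list_of_set (insert 0 J)"
  have set: "set L = insert 0 J" and sorted: "sorted L"
    unfolding L_def using assms by (simp_all only: set_sorted_list_of_set sorted_sorted_list_of_set finite_insert)
  then have len: "0 < length L"
    by auto
  define t where "t i = L ! min i (length L - 1)" for i
  have "t 0 = 0"
  proof -
    obtain i where "i < length L" "L ! i = 0"
      using set by (metis in_set_conv_nth insertI1)
    then have "L ! 0 \<le> 0"
      using sorted_nth_mono[OF sorted, of 0 i] by simp
    moreover have "0 \<le> L ! 0"
      using set nth_mem[OF len] assms(2) by auto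
    ultimately show ?thesis by (simp add: t_def)
  qed
  moreover have "incseq t"
    unfolding t_def
  proof (intro monoI sorted_nth_mono[OF sorted])
    fix i j :: nat
    assume "i \<le> j"
    then show "min i (length L - 1) \<le> min j (length L - 1)" by simp
    show "min j (length L - 1) < length L" using len by linarith
  qed
  moreover have "J \<subseteq> t ` {..length L}"
  proof
    fix x assume "x \<in> J"
    then obtain i where "i < length L" "L ! i = x"
      using set by (metis in_set_conv_nth insertI2)
    then show "x \<in> t ` {..length L}"
      by (intro image_eqI[of _ _ i]) (auto simp: t_def)
  qed
  ultimately show ?thesis
    using that len by blast
qed

definition restart :: "real \<Rightarrow> (real \<Rightarrow> real) \<Rightarrow> real \<Rightarrow> real" where
  "restart s x = (\<lambda>t\<in>{0..}. x (s + t) - x s)"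

lemma restart_measurable [measurable]: "0 \<le> s \<Longrightarrow> restart s \<in> path_space \<rightarrow>\<^sub>M path_space"
  unfolding restart_def
  by (intro measurable_restrict borel_measurable_diff measurable_component_singleton) auto

context levy_process
begin

text \<open>
  The increments of the restarted process along \<open>t\<close> are increments of \<open>X\<close> over intervals to the
  right of \<open>s\<close>. They are jointly independent of \<open>X s - X 0\<close>, and, by stationarity, jointly distributed
  like the increments of \<open>X\<close> along \<open>t\<close>. The values at the times \<open>t j\<close> are their partial sums.
\<close>

lemma prob_restarted_fdd:
  fixes t :: "nat \<Rightarrow> real" and C :: "nat \<Rightarrow> real set"
  assumes "0 \<le> s" "t 0 = 0" "incseq t" "0 < n"
    and [measurable]: "A \<in> sets borel" "\<And>j. C j \<in> sets borel"
  shows "\<P>(\<omega> in M. X s \<omega> \<in> A \<and> (\<forall>j\<in>{..n}. X (s + t j) \<omega> - X s \<omega> \<in> C j)) =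
    \<P>(\<omega> in M. X s \<omega> \<in> A) * \<P>(\<omega> in M. \<forall>j\<in>{..n}. X (t j) \<omega> \<in> C j)"
proof -
  have t_nonneg: "0 \<le> t i" for i
    using incseqD[OF \<open>incseq t\<close>, of 0 i] \<open>t 0 = 0\<close> by simp
  have [measurable]: "random_variable borel (X (t i))" "random_variable borel (X (s + t i))" for i
    using t_nonneg \<open>0 \<le> s\<close> by (auto intro!: random_variable_X)
  have [measurable]: "random_variable borel (X 0)" "random_variable borel (X s)"
    using \<open>0 \<le> s\<close> by (auto intro!: random_variable_X)
  let ?P = "\<Pi>\<^sub>M i\<in>{..<n}. (borel :: real measure)"
  \<comment> \<open>The times \<open>0, s, s + t 1, s + t 2, \<dots>\<close>, at which \<open>Y 0\<close> is the increment up to time \<open>s\<close>.\<close>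
  define r where "r i = (case i of 0 \<Rightarrow> 0 | Suc i \<Rightarrow> s + t i)" for i
  define Y where "Y i \<omega> = X (r (Suc i)) \<omega> - X (r i) \<omega>" for i \<omega>
  define V where "V \<omega> = (\<lambda>i\<in>{..<n}. X (s + t (Suc i)) \<omega> - X (s + t i) \<omega>)" for \<omega>
  define Z where "Z \<omega> = (\<lambda>i\<in>{..<n}. X (t (Suc i)) \<omega> - X (t i) \<omega>)" for \<omega>
  define D where "D = {f \<in> space ?P. \<forall>j\<in>{..n}. (\<Sum>i<j. f i) \<in> C j}"
  have [measurable]: "random_variable ?P V" "random_variable ?P Z"
    by (simp_all add: V_def[abs_def] Z_def[abs_def])
  have [measurable]: "(\<lambda>f. \<Sum>i<j. f i) \<in> borel_measurable ?P" if "j \<le> n" for j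
    using that by (intro borel_measurable_sum measurable_component_singleton) auto
  have D [measurable]: "D \<in> sets ?P"
    unfolding D_def by measurable
  have V_D: "V \<omega> \<in> D \<longleftrightarrow> (\<forall>j\<in>{..n}. X (s + t j) \<omega> - X s \<omega> \<in> C j)" for \<omega>
  proof -
    have "(\<Sum>i<j. V \<omega> i) = X (s + t j) \<omega> - X s \<omega>" if "j \<le> n" for j
      using that sum_lessThan_telescope[of "\<lambda>i. X (s + t i) \<omega>" j] \<open>t 0 = 0\<close> by (simp add: V_def)
    then show ?thesis
      by (auto simp: D_def space_PiM V_def)
  qed
  have Z_D: "Z \<omega> \<in> D \<longleftrightarrow> (\<forall>j\<in>{..n}. X (t j) \<omega> \<in> C j)" if "X 0 \<omega> = 0" for \<omega>
  proof -
    have "(\<Sum>i<j. Z \<omega> i) = X (t j) \<omega>" if "j \<le> n" for j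
      using that sum_lessThan_telescope[of "\<lambda>i. X (t i) \<omega>" j] \<open>t 0 = 0\<close> \<open>X 0 \<omega> = 0\<close> 
      by (simp add: Z_def)
    then show ?thesis
      by (auto simp: D_def space_PiM Z_def)
  qed
  have law: "distr M ?P V = distr M ?P Z"
  proof -
    have "distr M ?P V = (\<Pi>\<^sub>M i\<in>{..<n}. distr M borel (\<lambda>\<omega>. X (s + t (Suc i)) \<omega> - X (s + t i) \<omega>))"
      unfolding V_def using \<open>0 < n\<close> \<open>incseq t\<close> t_nonneg \<open>0 \<le> s\<close>
      by (intro iffD1[OF indep_vars_iff_distr_eq_PiM] independent_increments) (auto simp: incseq_def)
    also have "\<dots> = (\<Pi>\<^sub>M i\<in>{..<n}. distr M borel (\<lambda>\<omega>. X (t (Suc i)) \<omega> - X (t i) \<omega>))"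
    proof (intro PiM_cong refl)
      fix i
      have d: "0 \<le> t (Suc i) - t i"
        using incseq_SucD[OF \<open>incseq t\<close>, of i] by simp
      show "distr M borel (\<lambda>\<omega>. X (s + t (Suc i)) \<omega> - X (s + t i) \<omega>) =
          distr M borel (\<lambda>\<omega>. X (t (Suc i)) \<omega> - X (t i) \<omega>)"
        using stationary_increments[of "s + t i", OF _ d] stationary_increments[of "t i", OF _ d]
          t_nonneg[of i] \<open>0 \<le> s\<close> by simp
    qed
    also have "\<dots> = distr M ?P Z"
      unfolding Z_def using \<open>0 < n\<close> \<open>incseq t\<close> t_nonneg
      by (intro iffD1[OF indep_vars_iff_distr_eq_PiM, symmetric] independent_increments) auto
    finally show ?thesis .
  qed
  have indep: "indep_var (PiM {0} (\<lambda>_. borel)) (\<lambda>\<omega>. restrict (\<lambda>i. Y i \<omega>) {0}) ?P V"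
  proof -
    have "incseq r"
      using incseq_SucD[OF \<open>incseq t\<close>] \<open>0 \<le> s\<close> t_nonneg
      by (intro incseq_SucI) (auto simp: r_def split: nat.split)
    then have "indep_vars (\<lambda>_. borel) Y {..<Suc n}"
      unfolding Y_def by (intro independent_increments) (simp_all add: r_def[of 0])
    then have "indep_var (PiM {0} (\<lambda>_. borel)) (\<lambda>\<omega>. restrict (\<lambda>i. Y i \<omega>) {0})
        (PiM {1..<Suc n} (\<lambda>_. borel)) (\<lambda>\<omega>. restrict (\<lambda>i. Y i \<omega>) {1..<Suc n})"
      by (rule indep_var_restrict) auto
    then have "indep_var (PiM {0} (\<lambda>_. borel)) (id \<circ> (\<lambda>\<omega>. restrict (\<lambda>i. Y i \<omega>) {0}))
        ?P ((\<lambda>f. \<lambda>i\<in>{..<n}. f (Suc i)) \<circ> (\<lambda>\<omega>. restrict (\<lambda>i. Y i \<omega>) {1..<Suc n}))"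
      by (rule indep_var_compose)
        (auto intro!: measurable_restrict measurable_component_singleton)
    also have "(\<lambda>f. \<lambda>i\<in>{..<n}. f (Suc i)) \<circ> (\<lambda>\<omega>. restrict (\<lambda>i. Y i \<omega>) {1..<Suc n}) = V"
      by (auto simp: fun_eq_iff V_def Y_def r_def)
    finally show ?thesis
      unfolding id_comp .
  qed
  have Y0: "AE \<omega> in M. Y 0 \<omega> = X s \<omega>"
    using start_0 by (auto simp: Y_def r_def \<open>t 0 = 0\<close>)
  have [measurable]: "random_variable borel (Y 0)"
    by (simp add: Y_def[abs_def] r_def \<open>t 0 = 0\<close>)
  define A0 where "A0 = {f \<in> space (PiM {0::nat} (\<lambda>_. borel)). f 0 \<in> A}"
  have [measurable]: "A0 \<in> sets (PiM {0} (\<lambda>_. borel))"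
    unfolding A0_def by measurable
  have A0: "restrict (\<lambda>i. Y i \<omega>) {0} \<in> A0 \<longleftrightarrow> Y 0 \<omega> \<in> A" for \<omega>
    by (auto simp: A0_def space_PiM)
  have "\<P>(\<omega> in M. X s \<omega> \<in> A \<and> (\<forall>j\<in>{..n}. X (s + t j) \<omega> - X s \<omega> \<in> C j)) =
      \<P>(\<omega> in M. Y 0 \<omega> \<in> A \<and> V \<omega> \<in> D)"
    unfolding V_D using Y0 by (intro prob_eq_AE) auto
  also have "\<dots> = prob ((\<lambda>\<omega>. (restrict (\<lambda>i. Y i \<omega>) {0}, V \<omega>)) -` (A0 \<times> D) \<inter> space M)"
    by (intro arg_cong[where f = prob]) (auto simp: A0)
  also have "\<dots> = prob ((\<lambda>\<omega>. restrict (\<lambda>i. Y i \<omega>) {0}) -` A0 \<inter> space M) * prob (V -` D \<inter> space M)"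
    by (rule indep_varD[OF indep]) measurable
  also have "prob ((\<lambda>\<omega>. restrict (\<lambda>i. Y i \<omega>) {0}) -` A0 \<inter> space M) = \<P>(\<omega> in M. Y 0 \<omega> \<in> A)"
    by (intro arg_cong[where f = prob]) (auto simp: A0)
  also have "\<dots> = \<P>(\<omega> in M. X s \<omega> \<in> A)"
    using Y0 by (intro prob_eq_AE) auto
  also have "prob (V -` D \<inter> space M) = measure (distr M ?P V) D"
    by (simp add: measure_distr)
  also have "\<dots> = prob (Z -` D \<inter> space M)"
    by (simp add: measure_distr law)
  also have "\<dots> = \<P>(\<omega> in M. Z \<omega> \<in> D)"
    by (intro arg_cong[where f = prob]) auto
  also have "\<dots> = \<P>(\<omega> in M. \<forall>j\<in>{..n}. X (t j) \<omega> \<in> C j)"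
    using start_0 by (intro prob_eq_AE) (auto simp: Z_D)
  finally show ?thesis .
qed

definition sample_path :: "'a \<Rightarrow> real \<Rightarrow> real" where
  "sample_path \<omega> = (\<lambda>t\<in>{0..}. X t \<omega>)"

lemma sample_path_measurable [measurable]: "sample_path \<in> M \<rightarrow>\<^sub>M path_space"
  unfolding sample_path_def by (intro measurable_restrict random_variable_X) simp

text \<open>
  The simple Markov property at time \<open>s\<close> for the whole path: cylinder sets determine a finite measure
  on the path space, and on them the claim is \<open>prob_restarted_fdd\<close>.
\<close>

lemma distr_value_restart:
  assumes s: "0 \<le> s"
  shows "distr M (borel \<Otimes>\<^sub>M path_space) (\<lambda>\<omega>. (X s \<omega>, restart s (sample_path \<omega>))) =
    distr M borel (X s) \<Otimes>\<^sub>M distr M path_space sample_path"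
proof (rule pair_measure_eqI[symmetric])
  have X_s [measurable]: "random_variable borel (X s)"
    using s by (rule random_variable_X)
  have restart [measurable]: "(\<lambda>\<omega>. restart s (sample_path \<omega>)) \<in> M \<rightarrow>\<^sub>M path_space"
    using s by measurable
  interpret P: prob_space "distr M path_space sample_path"
    by (rule prob_space_distr) measurable
  interpret Q: prob_space "distr M borel (X s)"
    by (rule prob_space_distr) measurable
  show "sigma_finite_measure (distr M borel (X s))" "sigma_finite_measure (distr M path_space sample_path)"
    by unfold_locales
  show "sets (distr M borel (X s) \<Otimes>\<^sub>M distr M path_space sample_path) =
      sets (distr M (borel \<Otimes>\<^sub>M path_space) (\<lambda>\<omega>. (X s \<omega>, restart s (sample_path \<omega>))))"
    by (simp cong: sets_pair_measure_cong)
  fix A B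
  assume "A \<in> sets (distr M borel (X s))" "B \<in> sets (distr M path_space sample_path)"
  then have A [measurable]: "A \<in> sets borel" and B: "B \<in> sets path_space"
    by simp_all
  define E where "E = X s -` A \<inter> space M"
  have [measurable]: "E \<in> events"
    by (simp add: E_def)
  \<comment> \<open>With \<open>A\<close> fixed, both sides of the product formula are finite measures in \<open>B\<close>.\<close>
  let ?N = "distr (density M (indicator E)) path_space (\<lambda>\<omega>. restart s (sample_path \<omega>))"
  let ?K = "density (distr M path_space sample_path) (\<lambda>_. emeasure M E)"
  have N: "emeasure ?N F = emeasure M {\<omega> \<in> space M. X s \<omega> \<in> A \<and> restart s (sample_path \<omega>) \<in> F}"
    if [measurable]: "F \<in> sets path_space" for F
  proof -
    have "emeasure ?N F =
        (\<integral>\<^sup>+\<omega>. indicator E \<omega> * indicator ((\<lambda>\<omega>. restart s (sample_path \<omega>)) -` F \<inter> space M) \<omega> \<partial>M)"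
      by (simp add: emeasure_distr emeasure_density)
    also have "\<dots> = (\<integral>\<^sup>+\<omega>. indicator {\<omega> \<in> space M. X s \<omega> \<in> A \<and> restart s (sample_path \<omega>) \<in> F} \<omega> \<partial>M)"
      by (intro nn_integral_cong) (auto simp: E_def indicator_def)
    finally show ?thesis
      by simp
  qed
  have K: "emeasure ?K F = emeasure M E * emeasure M {\<omega> \<in> space M. sample_path \<omega> \<in> F}"
    if [measurable]: "F \<in> sets path_space" for F
    by (simp add: emeasure_density nn_integral_cmult_indicator emeasure_distr)
      (auto intro!: arg_cong[where f = "\<lambda>S. _ * emeasure M S"])
  have "?N = ?K"
  proof (rule measure_eqI_PiM_infinite)
    show "finite_measure ?N"
      by (intro finite_measureI, subst space_distr, subst N[OF sets.top]) (simp add: emeasure_eq_measure)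
    fix J and F :: "real \<Rightarrow> real set"
    assume J: "finite J" "J \<subseteq> {0..}" and F: "\<And>j. j \<in> J \<Longrightarrow> F j \<in> sets borel"
    let ?C = "prod_emb {0..} (\<lambda>_. borel) J (Pi\<^sub>E J F)"
    have C: "?C \<in> sets path_space"
      using J F by (intro sets_PiM_I) auto
    obtain t n where t: "t 0 = 0" "incseq t" "0 < n" "J \<subseteq> t ` {..n}"
      using finite_nonneg_set_enum[OF J] .
    define G where "G j = (if t j \<in> J then F (t j) else UNIV)" for j
    have t_nonneg: "0 \<le> t i" for i
      using incseqD[OF \<open>incseq t\<close>, of 0 i] \<open>t 0 = 0\<close> by simp
    have in_C: "x \<in> ?C \<longleftrightarrow> (\<forall>j\<in>{..n}. x (t j) \<in> G j)" if "x \<in> extensional {0..}" for x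
      using that t(4) J(2) by (force simp: prod_emb_def space_PiM PiE_def G_def)
    have ext: "sample_path \<omega> \<in> extensional {0..}" "restart s (sample_path \<omega>) \<in> extensional {0..}" for \<omega>
      by (simp_all add: sample_path_def restart_def)
    have "emeasure ?N ?C =
      emeasure M {\<omega> \<in> space M. X s \<omega> \<in> A \<and> (\<forall>j\<in>{..n}. X (s + t j) \<omega> - X s \<omega> \<in> G j)}"
      unfolding N[OF C] in_C[OF ext(2)] using s t_nonneg by (simp add: restart_def sample_path_def)
    also have "\<dots> = ennreal (\<P>(\<omega> in M. X s \<omega> \<in> A) * \<P>(\<omega> in M. \<forall>j\<in>{..n}. X (t j) \<omega> \<in> G j))"
      unfolding emeasure_eq_measure using s t F
      by (subst prob_restarted_fdd) (auto simp: G_def)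
    also have "\<dots> = emeasure ?K ?C"
      unfolding K[OF C] in_C[OF ext(1)] using t_nonneg
      by (simp add: sample_path_def E_def emeasure_eq_measure ennreal_mult vimage_def Int_def conj_commute)
    finally show "emeasure ?N ?C = emeasure ?K ?C" .
  qed simp_all
  then have "emeasure ?N B = emeasure ?K B"
    by simp
  then have "emeasure M {\<omega> \<in> space M. X s \<omega> \<in> A \<and> restart s (sample_path \<omega>) \<in> B} =
      emeasure M E * emeasure M {\<omega> \<in> space M. sample_path \<omega> \<in> B}"
    unfolding N[OF B] K[OF B] .
  then show "emeasure (distr M borel (X s)) A * emeasure (distr M path_space sample_path) B =
      emeasure (distr M (borel \<Otimes>\<^sub>M path_space) (\<lambda>\<omega>. (X s \<omega>, restart s (sample_path \<omega>)))) (A \<times> B)"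
    using B by (simp add: emeasure_distr E_def vimage_def Int_def conj_commute)
qed

end

section \<open>The killed process after a fixed time\<close>

context killed_levy_process
begin

abbreviation path_law :: "(real \<Rightarrow> real) measure" where
  "path_law \<equiv> distr M path_space sample_path"

abbreviation killing_law :: "ennreal measure" where
  "killing_law \<equiv> distr M borel \<zeta>"

declare random_variable_killing_time [measurable]

text \<open>
  For \<open>q = 0\<close> the killing time is almost surely \<open>\<infinity>\<close>, and \<open>\<infinity> - s = \<infinity>\<close>; so both cases take the same form.
\<close>

lemma killing_law_memoryless:
  assumes "0 \<le> s" and [measurable]: "G \<in> borel_measurable borel"
  shows "(\<integral>\<^sup>+z. of_bool (ennreal s < z) * G (z - ennreal s) \<partial>killing_law) =
    emeasure killing_law {ennreal s<..} * (\<integral>\<^sup>+z. G z \<partial>killing_law)"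
proof (cases "q = 0")
  case True
  then have inf: "AE \<omega> in M. \<zeta> \<omega> = \<infinity>"
    by (rule no_killing)
  have "(\<integral>\<^sup>+\<omega>. of_bool (ennreal s < \<zeta> \<omega>) * G (\<zeta> \<omega> - ennreal s) \<partial>M) = (\<integral>\<^sup>+\<omega>. G \<infinity> \<partial>M)"
    by (rule nn_integral_cong_AE) (use inf in eventually_elim, simp)
  moreover have "(\<integral>\<^sup>+\<omega>. G (\<zeta> \<omega>) \<partial>M) = (\<integral>\<^sup>+\<omega>. G \<infinity> \<partial>M)"
    by (rule nn_integral_cong_AE) (use inf in eventually_elim, simp)
  moreover have "emeasure killing_law {ennreal s<..} = 1"
    using inf by (subst emeasure_distr) (auto intro!: emeasure_eq_1_AE)
  ultimately show ?thesis
    by (simp add: nn_integral_distr emeasure_space_1)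
next
  case False
  then have law: "killing_law = distr (density lborel (exponential_density q)) borel ennreal"
    using rate_nonneg killing_time_exponential by simp
  have int: "(\<integral>\<^sup>+z. F z \<partial>killing_law) =
      (\<integral>\<^sup>+r. ennreal (exponential_density q r) * F (ennreal r) \<partial>lborel)"
    if [measurable]: "F \<in> borel_measurable borel" for F
    unfolding law by (simp add: nn_integral_distr nn_integral_density)
  have shift: "(\<integral>\<^sup>+z. of_bool (ennreal s < z) * F (z - ennreal s) \<partial>killing_law) =
      ennreal (exp (- s * q)) * (\<integral>\<^sup>+z. F z \<partial>killing_law)"
    if [measurable]: "F \<in> borel_measurable borel" for F
  proof -
    have "(\<integral>\<^sup>+z. of_bool (ennreal s < z) * F (z - ennreal s) \<partial>killing_law) =
        (\<integral>\<^sup>+r. ennreal (exponential_density q r) *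
          (of_bool (ennreal s < ennreal r) * F (ennreal r - ennreal s)) \<partial>lborel)"
      by (rule int) measurable
    also have "\<dots> = (\<integral>\<^sup>+r. ennreal (exponential_density q (s + r)) *
          (of_bool (ennreal s < ennreal (s + r)) * F (ennreal (s + r) - ennreal s)) \<partial>lborel)"
      by (subst nn_integral_real_affine[where c = 1 and t = s]) simp_all
    also have "\<dots> = (\<integral>\<^sup>+r. ennreal (exp (- s * q)) *
          (ennreal (exponential_density q r) * F (ennreal r)) \<partial>lborel)"
    proof (rule nn_integral_cong_AE, use AE_lborel_singleton[of 0] in eventually_elim)
      \<comment> \<open>At \<open>r = 0\<close> the density is \<open>q\<close> on the right, whereas \<open>s < s + r\<close> fails on the left.\<close>
      fix r :: real
      assume "r \<noteq> 0"
      show "ennreal (exponential_density q (s + r)) *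
            (of_bool (ennreal s < ennreal (s + r)) * F (ennreal (s + r) - ennreal s)) =
          ennreal (exp (- s * q)) * (ennreal (exponential_density q r) * F (ennreal r))"
      proof (cases "0 < r")
        case True
        have "exponential_density q (s + r) = exp (- s * q) * exponential_density q r"
          using True \<open>0 \<le> s\<close> by (simp add: exponential_density_def exp_add[symmetric] algebra_simps)
        moreover have "ennreal (s + r) - ennreal s = ennreal r"
          using True \<open>0 \<le> s\<close> by (simp add: ennreal_minus)
        ultimately show ?thesis
          using True \<open>0 \<le> s\<close> rate_nonneg
          by (simp add: ennreal_less_iff ennreal_mult' mult.assoc)
      next
        case False
        then show ?thesis
          using \<open>r \<noteq> 0\<close> \<open>0 \<le> s\<close> by (simp add: exponential_density_def ennreal_less_iff)
      qed
    qed
    also have "\<dots> = ennreal (exp (- s * q)) * (\<integral>\<^sup>+z. F z \<partial>killing_law)"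
      by (simp add: nn_integral_cmult int)
    finally show ?thesis .
  qed
  interpret K: prob_space killing_law
    by (rule prob_space_distr) measurable
  have "emeasure killing_law {ennreal s<..} = (\<integral>\<^sup>+z. indicator {ennreal s<..} z \<partial>killing_law)"
    by (rule nn_integral_indicator[symmetric]) simp
  also have "\<dots> = (\<integral>\<^sup>+z. of_bool (ennreal s < z) * 1 \<partial>killing_law)"
    by (intro nn_integral_cong) (simp add: indicator_def)
  also have "\<dots> = ennreal (exp (- s * q))"
    using shift[of "\<lambda>_. 1"] K.emeasure_space_1 by simp
  finally show ?thesis
    using shift[of G] by simp
qed

lemma distr_path_killing_time:
  "distr M (path_space \<Otimes>\<^sub>M borel) (\<lambda>\<omega>. (sample_path \<omega>, \<zeta> \<omega>)) = path_law \<Otimes>\<^sub>M killing_law"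
proof (rule pair_measure_eqI[symmetric])
  interpret P: prob_space path_law
    by (rule prob_space_distr) measurable
  interpret K: prob_space killing_law
    by (rule prob_space_distr) measurable
  show "sigma_finite_measure path_law" "sigma_finite_measure killing_law"
    by unfold_locales
  show "sets (path_law \<Otimes>\<^sub>M killing_law) =
      sets (distr M (path_space \<Otimes>\<^sub>M borel) (\<lambda>\<omega>. (sample_path \<omega>, \<zeta> \<omega>)))"
    by (simp cong: sets_pair_measure_cong)
  fix A B
  assume "A \<in> sets path_law" "B \<in> sets killing_law"
  then have [measurable]: "A \<in> sets path_space" "B \<in> sets borel"
    by simp_all
  have "prob ((sample_path -` A \<inter> space M) \<inter> (\<zeta> -` B \<inter> space M)) =
      prob (sample_path -` A \<inter> space M) * prob (\<zeta> -` B \<inter> space M)"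
    by (rule indep_setD[OF killing_time_independent])
      (auto intro!: in_vimage_algebra simp: sample_path_def[abs_def, symmetric])
  moreover have "(\<lambda>\<omega>. (sample_path \<omega>, \<zeta> \<omega>)) -` (A \<times> B) \<inter> space M =
      (sample_path -` A \<inter> space M) \<inter> (\<zeta> -` B \<inter> space M)"
    by auto
  ultimately show "emeasure path_law A * emeasure killing_law B =
      emeasure (distr M (path_space \<Otimes>\<^sub>M borel) (\<lambda>\<omega>. (sample_path \<omega>, \<zeta> \<omega>))) (A \<times> B)"
    by (simp add: emeasure_distr emeasure_eq_measure ennreal_mult')
qed

lemma nn_integral_path_killing_time:
  assumes [measurable]: "f \<in> borel_measurable (path_space \<Otimes>\<^sub>M borel)"
  shows "(\<integral>\<^sup>+\<omega>. f (sample_path \<omega>, \<zeta> \<omega>) \<partial>M) = (\<integral>\<^sup>+x. \<integral>\<^sup>+z. f (x, z) \<partial>killing_law \<partial>path_law)"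
proof -
  interpret K: prob_space killing_law
    by (rule prob_space_distr) measurable
  have "(\<integral>\<^sup>+\<omega>. f (sample_path \<omega>, \<zeta> \<omega>) \<partial>M) = (\<integral>\<^sup>+p. f p \<partial>(path_law \<Otimes>\<^sub>M killing_law))"
    unfolding distr_path_killing_time[symmetric] by (simp add: nn_integral_distr)
  also have "\<dots> = (\<integral>\<^sup>+x. \<integral>\<^sup>+z. f (x, z) \<partial>killing_law \<partial>path_law)"
    by (rule K.nn_integral_fst[symmetric]) (simp cong: measurable_cong_sets sets_pair_measure_cong)
  finally show ?thesis .
qed

text \<open>
  \<open>\<eta> s\<close> and the restarted path are functions of the path, hence jointly independent of \<open>\<zeta>\<close>. Integrating
  out \<open>\<zeta>\<close> first, by lack of memory, leaves the pair of \<open>\<eta> s\<close> and the restarted path, which is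
  independent by \<open>distr_value_restart\<close>.
\<close>

lemma nn_integral_value_restart_killing_time:
  assumes s: "0 \<le> s" and [measurable]: "f \<in> borel_measurable (borel \<Otimes>\<^sub>M (path_space \<Otimes>\<^sub>M borel))"
  shows "(\<integral>\<^sup>+\<omega>. of_bool (ennreal s < \<zeta> \<omega>) *
        f (\<eta> s \<omega>, restart s (sample_path \<omega>), \<zeta> \<omega> - ennreal s) \<partial>M) =
    emeasure killing_law {ennreal s<..} *
      (\<integral>\<^sup>+y. \<integral>\<^sup>+\<omega>. f (y, sample_path \<omega>, \<zeta> \<omega>) \<partial>M \<partial>distr M borel (\<eta> s))"
proof -
  interpret P: prob_space path_law
    by (rule prob_space_distr) measurable
  interpret K: prob_space killing_law
    by (rule prob_space_distr) measurable
  have [measurable]: "random_variable borel (\<eta> s)" "restart s \<in> path_space \<rightarrow>\<^sub>M path_space"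
    "(\<lambda>x. x s) \<in> borel_measurable path_space"
    using s by (auto intro!: random_variable_X)
  have [measurable]: "(\<lambda>p. \<integral>\<^sup>+z. f (fst p, snd p, z) \<partial>killing_law)
      \<in> borel_measurable (borel \<Otimes>\<^sub>M path_space)"
    by measurable
  have eta_s: "sample_path \<omega> s = \<eta> s \<omega>" for \<omega>
    using s by (simp add: sample_path_def)
  let ?c = "emeasure killing_law {ennreal s<..}"
  have "(\<integral>\<^sup>+\<omega>. of_bool (ennreal s < \<zeta> \<omega>) *
        f (\<eta> s \<omega>, restart s (sample_path \<omega>), \<zeta> \<omega> - ennreal s) \<partial>M) =
      (\<integral>\<^sup>+x. \<integral>\<^sup>+z. of_bool (ennreal s < z) * f (x s, restart s x, z - ennreal s)
        \<partial>killing_law \<partial>path_law)"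
    unfolding eta_s[symmetric]
    by (rule nn_integral_path_killing_time[where f = "\<lambda>(x, z). of_bool (ennreal s < z) *
      f (x s, restart s x, z - ennreal s)", simplified]) measurable
  also have "\<dots> = (\<integral>\<^sup>+x. ?c * (\<integral>\<^sup>+z. f (x s, restart s x, z) \<partial>killing_law) \<partial>path_law)"
    using s by (intro nn_integral_cong killing_law_memoryless) (auto simp: space_PiM restart_def)
  also have "\<dots> = ?c * (\<integral>\<^sup>+\<omega>. (\<integral>\<^sup>+z. f (\<eta> s \<omega>, restart s (sample_path \<omega>), z) \<partial>killing_law) \<partial>M)"
    by (simp add: nn_integral_cmult nn_integral_distr eta_s)
  also have "(\<integral>\<^sup>+\<omega>. (\<integral>\<^sup>+z. f (\<eta> s \<omega>, restart s (sample_path \<omega>), z) \<partial>killing_law) \<partial>M) =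
      (\<integral>\<^sup>+p. (\<integral>\<^sup>+z. f (fst p, snd p, z) \<partial>killing_law) \<partial>(distr M borel (\<eta> s) \<Otimes>\<^sub>M path_law))"
    unfolding distr_value_restart[OF s, symmetric] by (simp add: nn_integral_distr)
  also have "\<dots> = (\<integral>\<^sup>+y. \<integral>\<^sup>+x. \<integral>\<^sup>+z. f (y, x, z) \<partial>killing_law \<partial>path_law \<partial>distr M borel (\<eta> s))"
    by (subst P.nn_integral_fst[symmetric])
      (simp_all cong: measurable_cong_sets sets_pair_measure_cong)
  also have "\<dots> = (\<integral>\<^sup>+y. \<integral>\<^sup>+\<omega>. f (y, sample_path \<omega>, \<zeta> \<omega>) \<partial>M \<partial>distr M borel (\<eta> s))"
    by (intro nn_integral_cong nn_integral_path_killing_time[symmetric]) simp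
  finally show ?thesis .
qed

text \<open>
  Given survival up to time \<open>s\<close>, the restarted process with its residual lifetime is a copy of the
  original one, independent of \<open>\<eta> s\<close>. Both sides are instances of the preceding formula: the right-hand
  side is the one for an integrand that depends on the first argument only.
\<close>

lemma markov_property_on_survival:
  assumes s: "0 \<le> s" and [measurable]: "f \<in> borel_measurable (borel \<Otimes>\<^sub>M (path_space \<Otimes>\<^sub>M borel))"
  shows "(\<integral>\<^sup>+\<omega>. of_bool (ennreal s < \<zeta> \<omega>) *
        f (\<eta> s \<omega>, restart s (sample_path \<omega>), \<zeta> \<omega> - ennreal s) \<partial>M) =
    (\<integral>\<^sup>+\<omega>. of_bool (ennreal s < \<zeta> \<omega>) *
        (\<integral>\<^sup>+\<omega>'. f (\<eta> s \<omega>, sample_path \<omega>', \<zeta> \<omega>') \<partial>M) \<partial>M)"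
proof -
  define g where "g p = (\<integral>\<^sup>+\<omega>'. f (fst p, sample_path \<omega>', \<zeta> \<omega>') \<partial>M)"
    for p :: "real \<times> (real \<Rightarrow> real) \<times> ennreal"
  have [measurable]: "g \<in> borel_measurable (borel \<Otimes>\<^sub>M (path_space \<Otimes>\<^sub>M borel))"
    unfolding g_def by measurable
  show ?thesis
    using nn_integral_value_restart_killing_time[OF s, of f]
      nn_integral_value_restart_killing_time[OF s, of g]
    by (simp add: g_def emeasure_space_1)
qed

end

section \<open>Exponential functional and renewal measure in terms of the path\<close>

lemma right_value_restrict: "right_value (restrict x {0..}) u = right_value x u"
  using grid_after_nonneg by (simp add: right_value_def)

text \<open>
  The right limit of \<open>x\<close> is taken at \<open>s + u\<close> along times that need not lie on the grid of that point;
  right-continuity makes this harmless.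
\<close>

lemma right_value_restart:
  assumes "cadlag x" "0 \<le> s" "0 \<le> u"
  shows "right_value (restart s (restrict x {0..})) u = x (s + u) - x s"
proof -
  have "(x \<longlongrightarrow> x (s + u)) (at_right (s + u))"
    using assms by (auto simp: cadlag_def continuous_within)
  moreover have "filterlim (\<lambda>t. s + t) (at_right (s + u)) (at_right u)"
    unfolding filterlim_at by (auto intro!: tendsto_eq_intros simp: eventually_at_filter)
  ultimately have "((\<lambda>t. x (s + t)) \<longlongrightarrow> x (s + u)) (at_right u)"
    by (rule filterlim_compose)
  then have "continuous (at_right u) (\<lambda>t. x (s + t) - x s)"
    by (auto simp: continuous_within intro!: tendsto_intros)
  then have "right_value (\<lambda>t. x (s + t) - x s) u = x (s + u) - x s"
    using \<open>0 \<le> u\<close> by (intro right_value_eq)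
  also have "right_value (\<lambda>t. x (s + t) - x s) u = right_value (restart s (restrict x {0..})) u"
    using grid_after_nonneg \<open>0 \<le> s\<close> by (simp add: right_value_def restart_def)
  finally show ?thesis by simp
qed

text \<open>
  Translating time by \<open>s\<close> turns \<open>exp x\<^sub>s\<^sub>+\<^sub>u\<close> into \<open>exp x\<^sub>s\<close> times the exponential of the restarted path.
\<close>

lemma tail_path_functional:
  assumes x: "cadlag x" and s: "0 \<le> s" "ennreal s < z"
  shows "(\<integral>\<^sup>+u. clock_rate (restrict x {0..}) z u * indicator {s..} u \<partial>lborel) =
    ennreal (exp (x s)) * path_functional (restart s (restrict x {0..})) (z - ennreal s)"
proof -
  have [measurable]: "restrict x {0..} \<in> space path_space" 
    "restart s (restrict x {0..}) \<in> space path_space"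
    by (auto simp: space_PiM restart_def)
  have [measurable]: "right_value y \<in> borel_measurable borel" if "y \<in> space path_space" for y
    using measurable_compose[OF measurable_Pair1'[OF that] right_value_measurable] by simp
  have less: "ennreal (s + u) < z \<longleftrightarrow> ennreal u < z - ennreal s" if "0 \<le> u" for u
    using that s by (cases z) (auto simp: ennreal_minus ennreal_less_iff simp del: ennreal_plus)
  have "(\<integral>\<^sup>+u. clock_rate (restrict x {0..}) z u * indicator {s..} u \<partial>lborel) =
      (\<integral>\<^sup>+u. clock_rate (restrict x {0..}) z (s + u) * indicator {s..} (s + u) \<partial>lborel)"
    by (subst nn_integral_real_affine[where c = 1 and t = s]) (simp_all add: clock_rate_def)
  also have "\<dots> = (\<integral>\<^sup>+u. ennreal (exp (x s)) *
      clock_rate (restart s (restrict x {0..})) (z - ennreal s) u \<partial>lborel)"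
  proof (rule nn_integral_cong)
    fix u
    show "clock_rate (restrict x {0..}) z (s + u) * indicator {s..} (s + u) =
        ennreal (exp (x s)) * clock_rate (restart s (restrict x {0..})) (z - ennreal s) u"
    proof (cases "0 \<le> u")
      case True
      have "right_value (restrict x {0..}) (s + u) = x (s + u)"
        using x s True by (simp add: right_value_restrict right_value_eq cadlag_def)
      then show ?thesis
        using True s x less[OF True]
        by (simp add: clock_rate_def right_value_restart ennreal_mult'[symmetric] exp_add[symmetric])
    qed (simp add: clock_rate_def)
  qed
  also have "\<dots> = ennreal (exp (x s)) * path_functional (restart s (restrict x {0..})) (z - ennreal s)"
    unfolding path_functional_def by (rule nn_integral_cmult) (simp add: clock_rate_def)
  finally show ?thesis .
qed

context killed_levy_process
begin

lemma sample_path_restrict: "sample_path \<omega> = restrict (\<lambda>t. \<eta> t \<omega>) {0..}"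
  by (simp add: sample_path_def)

lemma right_value_sample_path:
  "cadlag (\<lambda>t. \<eta> t \<omega>) \<Longrightarrow> 0 \<le> u \<Longrightarrow> right_value (sample_path \<omega>) u = \<eta> u \<omega>"
  by (simp add: sample_path_restrict right_value_restrict right_value_eq cadlag_def)

lemma right_value_sample_path_measurable [measurable]:
  "(\<lambda>(\<omega>, u). right_value (sample_path \<omega>) u) \<in> borel_measurable (M \<Otimes>\<^sub>M borel)"
  by measurable

lemma exponential_functional_eq:
  assumes "cadlag (\<lambda>t. \<eta> t \<omega>)"
  shows "exponential_functional (killed \<eta> \<zeta>) \<zeta> \<omega> = path_functional (sample_path \<omega>) (\<zeta> \<omega>)"
  unfolding exponential_functional_def path_functional_def clock_rate_def
  by (intro nn_integral_cong)
    (auto simp: lifetime_def killed_def exp_ereal_def indicator_def right_value_sample_path[OF assms])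

text \<open>
  As the image of a measure on \<open>\<Omega> \<times> \<real>\<close> the renewal measure is seen to be \<open>\<sigma>\<close>-additive, and integrals
  against it become integrals over time and chance, to which Fubini's theorem applies.
\<close>

lemma renewal_measure_eq:
  "renewal_measure M (killed \<eta> \<zeta>) \<zeta> =
    distr (density (M \<Otimes>\<^sub>M lborel) (\<lambda>(\<omega>, s). of_bool (0 \<le> s \<and> ennreal s < \<zeta> \<omega>))) borel
      (\<lambda>(\<omega>, s). right_value (sample_path \<omega>) s)" (is "_ = ?N")
proof -
  have e: "(\<integral>\<^sup>+\<omega>. (\<integral>\<^sup>+t\<in>lifetime \<zeta> \<omega>. indicator (ereal ` B) (killed \<eta> \<zeta> t \<omega>) \<partial>lborel) \<partial>M) = emeasure ?N B"
    if [measurable]: "B \<in> sets borel" for B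
  proof -
    let ?W = "\<lambda>\<omega> s. of_bool (0 \<le> s \<and> ennreal s < \<zeta> \<omega>) * (indicator B (right_value (sample_path \<omega>) s) :: ennreal)"
    have [measurable]: "(\<lambda>p. indicator B (right_value (sample_path (fst p)) (snd p)) :: ennreal)
        \<in> borel_measurable (M \<Otimes>\<^sub>M lborel)"
      by (rule measurable_compose[of _ _ borel]) measurable
    have "emeasure ?N B = (\<integral>\<^sup>+p. indicator B p \<partial>?N)"
      by simp
    also have "\<dots> = (\<integral>\<^sup>+p. (\<lambda>(\<omega>, s). ?W \<omega> s) p \<partial>(M \<Otimes>\<^sub>M lborel))"
      by (subst nn_integral_distr, measurable, subst nn_integral_density, measurable)
        (auto intro!: nn_integral_cong)
    also have "\<dots> = (\<integral>\<^sup>+\<omega>. \<integral>\<^sup>+s. ?W \<omega> s \<partial>lborel \<partial>M)"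
      by (subst lborel.nn_integral_fst[symmetric]) (simp_all add: case_prod_beta)
    also have "\<dots> = (\<integral>\<^sup>+\<omega>. (\<integral>\<^sup>+t\<in>lifetime \<zeta> \<omega>. indicator (ereal ` B) (killed \<eta> \<zeta> t \<omega>) \<partial>lborel) \<partial>M)"
    proof (rule nn_integral_cong_AE, use cadlag_paths in eventually_elim, rule nn_integral_cong)
      fix \<omega> s
      assume "cadlag (\<lambda>t. \<eta> t \<omega>)"
      then show "?W \<omega> s = indicator (ereal ` B) (killed \<eta> \<zeta> s \<omega>) * indicator (lifetime \<zeta> \<omega>) s"
        by (auto simp: lifetime_def killed_def indicator_def right_value_sample_path)
    qed
    finally show ?thesis by simp
  qed
  have "renewal_measure M (killed \<eta> \<zeta>) \<zeta> = measure_of (space ?N) (sets ?N) (emeasure ?N)"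
    unfolding renewal_measure_def by (auto intro!: measure_of_eq simp: e sets.sigma_sets_eq[of borel, simplified])
  then show ?thesis
    by (simp only: measure_of_of_measure)
qed

lemma nn_integral_renewal_measure:
  assumes [measurable]: "f \<in> borel_measurable borel"
  shows "(\<integral>\<^sup>+y. f y \<partial>renewal_measure M (killed \<eta> \<zeta>) \<zeta>) =
    (\<integral>\<^sup>+p. (case p of (\<omega>, s) \<Rightarrow> of_bool (0 \<le> s \<and> ennreal s < \<zeta> \<omega>) *
      f (right_value (sample_path \<omega>) s)) \<partial>(M \<Otimes>\<^sub>M lborel))"
  unfolding renewal_measure_eq
  by (subst nn_integral_distr, measurable, subst nn_integral_density, measurable)
    (auto intro!: nn_integral_cong)

section \<open>The truncated mean of the exponential functional\<close>

context
  fixes k :: "real \<Rightarrow> real" and I :: "'a \<Rightarrow> ennreal"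
  defines "I \<equiv> \<lambda>\<omega>. path_functional (sample_path \<omega>) (\<zeta> \<omega>)"
  assumes k: "has_probability_density M (exponential_functional (killed \<eta> \<zeta>) \<zeta>) k"
begin

lemma functional_measurable [measurable]: "I \<in> borel_measurable M"
  unfolding I_def by measurable

lemma density_nonneg: "0 \<le> k x"
  using k by (simp add: has_probability_density_def)

lemma distributed_functional: "distributed M lborel (\<lambda>\<omega>. enn2real (I \<omega>)) (\<lambda>x. ennreal (k x))"
proof -
  have "distributed M lborel (\<lambda>\<omega>. enn2real (exponential_functional (killed \<eta> \<zeta>) \<zeta> \<omega>)) (\<lambda>x. ennreal (k x))"
    using k by (simp add: has_probability_density_def)
  moreover have "AE \<omega> in M. enn2real (exponential_functional (killed \<eta> \<zeta>) \<zeta> \<omega>) = enn2real (I \<omega>)"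
    using cadlag_paths by eventually_elim (simp add: exponential_functional_eq I_def)
  ultimately show ?thesis
    unfolding distributed_def
    by (auto cong: distr_cong_AE) (subst (asm) distr_cong_AE, auto)
qed

lemma density_measurable [measurable]: "k \<in> borel_measurable borel"
proof -
  have "(\<lambda>x. enn2real (ennreal (k x))) \<in> borel_measurable borel"
    using distributed_borel_measurable[OF distributed_functional] by (intro borel_measurable_enn2real) simp
  then show ?thesis
    by (simp add: density_nonneg)
qed

text \<open>
  A law with a density has no atom at \<open>0\<close>, and \<open>enn2real\<close> sends \<open>\<infinity>\<close> to \<open>0\<close>.
\<close>

lemma functional_pos_finite: "AE \<omega> in M. 0 < I \<omega> \<and> I \<omega> < \<infinity>"
proof -
  have "AE x in lborel. 0 < ennreal (k x) \<longrightarrow> x \<noteq> 0"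
    using AE_lborel_singleton[of 0] by eventually_elim simp
  then have "AE \<omega> in M. enn2real (I \<omega>) \<noteq> 0"
    using distributed_AE2[OF distributed_functional, of "\<lambda>x. x \<noteq> 0"] by simp
  then show ?thesis
  proof eventually_elim
    case (elim \<omega>)
    then show ?case by (cases "I \<omega>") (auto simp: less_top[symmetric])
  qed
qed

lemma emeasure_functional_greater:
  assumes "0 < t"
  shows "emeasure M {\<omega> \<in> space M. ennreal t < I \<omega>} = (\<integral>\<^sup>+s\<in>{t<..}. ennreal (k s) \<partial>lborel)"
proof -
  have "emeasure M {\<omega> \<in> space M. ennreal t < I \<omega>} =
      emeasure M ((\<lambda>\<omega>. enn2real (I \<omega>)) -` {t<..} \<inter> space M)"
  proof (rule emeasure_eq_AE)
    show "AE \<omega> in M. \<omega> \<in> {\<omega> \<in> space M. ennreal t < I \<omega>} \<longleftrightarrow>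
        \<omega> \<in> (\<lambda>\<omega>. enn2real (I \<omega>)) -` {t<..} \<inter> space M"
      using functional_pos_finite
    proof eventually_elim
      case (elim \<omega>)
      then show ?case using \<open>0 < t\<close> by (cases "I \<omega>") (auto simp: ennreal_less_iff)
    qed
  qed measurable
  also have "\<dots> = (\<integral>\<^sup>+s\<in>{t<..}. ennreal (k s) \<partial>lborel)"
    by (rule distributed_emeasure[OF distributed_functional]) simp
  finally show ?thesis .
qed

text \<open>
  The substitution \<open>v = exp y \<cdot> x\<close>. The factor \<open>exp y\<close> is the speed at which the tail integral decreases,
  and cancels against the Jacobian; this is why \<open>k\<close> enters the renewal equation without a weight.
\<close>

lemma emeasure_scaled_functional_le:
  "ennreal (exp y) * emeasure M {\<omega> \<in> space M. ennreal (exp y) * I \<omega> \<le> ennreal a} =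
    (\<integral>\<^sup>+v. of_bool (0 < v \<and> v \<le> a) * ennreal (k (v * exp (- y))) \<partial>lborel)"
proof -
  have "emeasure M {\<omega> \<in> space M. ennreal (exp y) * I \<omega> \<le> ennreal a} =
      emeasure M ((\<lambda>\<omega>. enn2real (I \<omega>)) -` {x. 0 < x \<and> exp y * x \<le> a} \<inter> space M)"
  proof (rule emeasure_eq_AE)
    show "AE \<omega> in M. \<omega> \<in> {\<omega> \<in> space M. ennreal (exp y) * I \<omega> \<le> ennreal a} \<longleftrightarrow>
        \<omega> \<in> (\<lambda>\<omega>. enn2real (I \<omega>)) -` {x. 0 < x \<and> exp y * x \<le> a} \<inter> space M"
      using functional_pos_finite
    proof eventually_elim
      case (elim \<omega>)
      then obtain x where x: "I \<omega> = ennreal x" "0 < x"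
        by (cases "I \<omega>") (auto simp: ennreal_less_iff)
      then have pos: "\<not> exp y * x \<le> 0"
        by (simp add: mult_le_0_iff)
      have "ennreal (exp y * x) \<le> ennreal a \<longleftrightarrow> exp y * x \<le> a"
        unfolding ennreal_le_iff2 using pos by auto
      then have "ennreal (exp y) * ennreal x \<le> ennreal a \<longleftrightarrow> exp y * x \<le> a"
        by (simp add: ennreal_mult')
      then show ?case
        using x by auto
    qed
  qed measurable
  also have "\<dots> = (\<integral>\<^sup>+x\<in>{x. 0 < x \<and> exp y * x \<le> a}. ennreal (k x) \<partial>lborel)"
    by (rule distributed_emeasure[OF distributed_functional]) simp
  also have "ennreal (exp y) * \<dots> = ennreal (exp y) *
      (\<integral>\<^sup>+x. of_bool (0 < exp y * x \<and> exp y * x \<le> a) * ennreal (k ((exp y * x) * exp (- y))) \<partial>lborel)"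
  proof (rule arg_cong[where f = "\<lambda>i. ennreal (exp y) * i"], rule nn_integral_cong)
    fix x
    have "exp y * x * exp (- y) = x"
      by (simp add: exp_minus)
    show "ennreal (k x) * indicator {x. 0 < x \<and> exp y * x \<le> a} x =
        of_bool (0 < exp y * x \<and> exp y * x \<le> a) * ennreal (k (exp y * x * exp (- y)))"
      unfolding \<open>exp y * x * exp (- y) = x\<close> by (simp add: zero_less_mult_iff indicator_def)
  qed
  also have "\<dots> = (\<integral>\<^sup>+v. of_bool (0 < v \<and> v \<le> a) * ennreal (k (v * exp (- y))) \<partial>lborel)"
    by (subst (2) nn_integral_real_affine[where c = "exp y" and t = 0]) simp_all
  finally show ?thesis .
qed

text \<open>
  The expected integrand of the substitution formula at time \<open>s\<close>: the tail integral is
  \<open>exp (\<eta> s)\<close> times an independent copy of \<open>I\<close>, whose law is integrated out by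
  \<open>emeasure_scaled_functional_le\<close>.
\<close>

lemma expectation_at_fixed_time:
  assumes "0 \<le> s"
  shows "(\<integral>\<^sup>+\<omega>. clock_rate (sample_path \<omega>) (\<zeta> \<omega>) s * indicator {..ennreal a}
        (\<integral>\<^sup>+u. clock_rate (sample_path \<omega>) (\<zeta> \<omega>) u * indicator {s..} u \<partial>lborel) \<partial>M) =
    (\<integral>\<^sup>+\<omega>. of_bool (ennreal s < \<zeta> \<omega>) * (\<integral>\<^sup>+v. of_bool (0 < v \<and> v \<le> a) *
        ennreal (k (v * exp (- right_value (sample_path \<omega>) s))) \<partial>lborel) \<partial>M)"
    (is "?L = ?R")
proof -
  define f where "f p = (case p of (y, x, z) \<Rightarrow>
      ennreal (exp y) * indicator {..ennreal a} (ennreal (exp y) * path_functional x z))"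
    for p :: "real \<times> (real \<Rightarrow> real) \<times> ennreal"
  have [measurable]: "f \<in> borel_measurable (borel \<Otimes>\<^sub>M (path_space \<Otimes>\<^sub>M borel))"
    unfolding f_def by measurable
  have "?L = (\<integral>\<^sup>+\<omega>. of_bool (ennreal s < \<zeta> \<omega>) *
      f (\<eta> s \<omega>, restart s (sample_path \<omega>), \<zeta> \<omega> - ennreal s) \<partial>M)"
  proof (rule nn_integral_cong_AE, use cadlag_paths in eventually_elim)
    fix \<omega>
    assume \<omega>: "cadlag (\<lambda>t. \<eta> t \<omega>)"
    show "clock_rate (sample_path \<omega>) (\<zeta> \<omega>) s * indicator {..ennreal a}
          (\<integral>\<^sup>+u. clock_rate (sample_path \<omega>) (\<zeta> \<omega>) u * indicator {s..} u \<partial>lborel) =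
        of_bool (ennreal s < \<zeta> \<omega>) * f (\<eta> s \<omega>, restart s (sample_path \<omega>), \<zeta> \<omega> - ennreal s)"
    proof (cases "ennreal s < \<zeta> \<omega>")
      case True
      with tail_path_functional[OF \<omega> \<open>0 \<le> s\<close> True] \<open>0 \<le> s\<close> show ?thesis
        by (simp add: sample_path_restrict[symmetric] f_def clock_rate_def right_value_sample_path[OF \<omega>])
    qed (simp add: clock_rate_def)
  qed
  also have "\<dots> = (\<integral>\<^sup>+\<omega>. of_bool (ennreal s < \<zeta> \<omega>) *
      (\<integral>\<^sup>+\<omega>'. f (\<eta> s \<omega>, sample_path \<omega>', \<zeta> \<omega>') \<partial>M) \<partial>M)"
    using \<open>0 \<le> s\<close> by (rule markov_property_on_survival) measurable
  also have "\<dots> = ?R"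
  proof (rule nn_integral_cong_AE, use cadlag_paths in eventually_elim)
    fix \<omega>
    assume \<omega>: "cadlag (\<lambda>t. \<eta> t \<omega>)"
    let ?y = "right_value (sample_path \<omega>) s"
    have y: "?y = \<eta> s \<omega>"
      using \<omega> \<open>0 \<le> s\<close> by (rule right_value_sample_path)
    have "(\<integral>\<^sup>+\<omega>'. f (\<eta> s \<omega>, sample_path \<omega>', \<zeta> \<omega>') \<partial>M) =
        (\<integral>\<^sup>+\<omega>'. ennreal (exp ?y) * indicator {\<omega> \<in> space M. ennreal (exp ?y) * I \<omega> \<le> ennreal a} \<omega>' \<partial>M)"
      by (intro nn_integral_cong) (auto simp: f_def y I_def indicator_def)
    also have "\<dots> = (\<integral>\<^sup>+v. of_bool (0 < v \<and> v \<le> a) * ennreal (k (v * exp (- ?y))) \<partial>lborel)"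
      by (subst nn_integral_cmult_indicator) (simp_all add: emeasure_scaled_functional_le)
    finally show "of_bool (ennreal s < \<zeta> \<omega>) * (\<integral>\<^sup>+\<omega>'. f (\<eta> s \<omega>, sample_path \<omega>', \<zeta> \<omega>') \<partial>M) =
        of_bool (ennreal s < \<zeta> \<omega>) *
          (\<integral>\<^sup>+v. of_bool (0 < v \<and> v \<le> a) * ennreal (k (v * exp (- ?y))) \<partial>lborel)"
      by simp
  qed
  finally show ?thesis .
qed

lemma truncated_expectation_eq_tail:
  assumes "0 < a"
  shows "(\<integral>\<^sup>+\<omega>. min (I \<omega>) (ennreal a) \<partial>M) =
    (\<integral>\<^sup>+t. of_bool (0 < t \<and> t \<le> a) * emeasure M {\<omega> \<in> space M. ennreal t < I \<omega>} \<partial>lborel)"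
proof -
  interpret P: pair_sigma_finite M lborel ..
  have "(\<integral>\<^sup>+\<omega>. min (I \<omega>) (ennreal a) \<partial>M) =
      (\<integral>\<^sup>+\<omega>. \<integral>\<^sup>+t. of_bool (0 < t \<and> t \<le> a \<and> ennreal t < I \<omega>) \<partial>lborel \<partial>M)"
    using \<open>0 < a\<close> by (simp add: nn_integral_indicator_below)
  also have "\<dots> = (\<integral>\<^sup>+t. \<integral>\<^sup>+\<omega>. of_bool (0 < t \<and> t \<le> a \<and> ennreal t < I \<omega>) \<partial>M \<partial>lborel)"
    by (rule P.Fubini'[symmetric]) measurable
  also have "\<dots> = (\<integral>\<^sup>+t. of_bool (0 < t \<and> t \<le> a) * emeasure M {\<omega> \<in> space M. ennreal t < I \<omega>} \<partial>lborel)"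
  proof (rule nn_integral_cong)
    fix t
    have "(\<integral>\<^sup>+\<omega>. of_bool (0 < t \<and> t \<le> a \<and> ennreal t < I \<omega>) \<partial>M) =
        (\<integral>\<^sup>+\<omega>. of_bool (0 < t \<and> t \<le> a) * indicator {\<omega> \<in> space M. ennreal t < I \<omega>} \<omega> \<partial>M)"
      by (intro nn_integral_cong) (auto simp: indicator_def)
    also have "\<dots> = of_bool (0 < t \<and> t \<le> a) * emeasure M {\<omega> \<in> space M. ennreal t < I \<omega>}"
      by (rule nn_integral_cmult_indicator) measurable
    finally show "(\<integral>\<^sup>+\<omega>. of_bool (0 < t \<and> t \<le> a \<and> ennreal t < I \<omega>) \<partial>M) = \<dots>" .
  qed
  finally show ?thesis .
qed

lemma density_renewal_measurable [measurable]:
  "(\<lambda>t. \<integral>\<^sup>+y. ennreal (k (t * exp (- y))) \<partial>renewal_measure M (killed \<eta> \<zeta>) \<zeta>) \<in> borel_measurable borel"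
proof -
  interpret P: pair_sigma_finite M lborel ..
  show ?thesis
    by (subst nn_integral_renewal_measure) measurable
qed

text \<open>
  Fubini's theorem is used twice: to take the expectation at fixed times, and, once the Markov
  property has brought in \<open>k\<close>, to integrate over time and chance first, which gives the renewal measure.
\<close>

lemma truncated_expectation_eq_renewal:
  assumes "0 < a"
  shows "(\<integral>\<^sup>+\<omega>. min (I \<omega>) (ennreal a) \<partial>M) =
    (\<integral>\<^sup>+t. of_bool (0 < t \<and> t \<le> a) *
      (\<integral>\<^sup>+y. ennreal (k (t * exp (- y))) \<partial>renewal_measure M (killed \<eta> \<zeta>) \<zeta>) \<partial>lborel)"
proof -
  interpret P: pair_sigma_finite M lborel ..
  interpret PP: pair_sigma_finite "M \<Otimes>\<^sub>M lborel" lborel ..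
  define A where "A \<omega> s \<longleftrightarrow> 0 \<le> s \<and> ennreal s < \<zeta> \<omega>" for \<omega> s
  have [measurable]: "Measurable.pred (M \<Otimes>\<^sub>M lborel) (\<lambda>p. A (fst p) (snd p))"
    unfolding A_def by measurable
  let ?rv = "\<lambda>\<omega>. right_value (sample_path \<omega>)"
  let ?w = "\<lambda>\<omega>. clock_rate (sample_path \<omega>) (\<zeta> \<omega>)"
  let ?h = "\<lambda>y. \<integral>\<^sup>+v. of_bool (0 < v \<and> v \<le> a) * ennreal (k (v * exp (- y))) \<partial>lborel"
  have [measurable]: "(\<lambda>(\<omega>, s). ?w \<omega> s) \<in> borel_measurable (M \<Otimes>\<^sub>M lborel)"
    unfolding clock_rate_def by measurable
  have [measurable]: "?w \<omega> \<in> borel_measurable borel" if "\<omega> \<in> space M" for \<omega>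
    using measurable_compose[OF measurable_Pair1'[OF that]
      \<open>(\<lambda>(\<omega>, s). ?w \<omega> s) \<in> borel_measurable (M \<Otimes>\<^sub>M lborel)\<close>] by simp
  have "(\<integral>\<^sup>+\<omega>. min (I \<omega>) (ennreal a) \<partial>M) =
      (\<integral>\<^sup>+\<omega>. \<integral>\<^sup>+s. ?w \<omega> s * indicator {..ennreal a}
        (\<integral>\<^sup>+u. ?w \<omega> u * indicator {s..} u \<partial>lborel) \<partial>lborel \<partial>M)"
  proof (rule nn_integral_cong_AE, use functional_pos_finite AE_space in eventually_elim)
    fix \<omega>
    assume \<omega>: "0 < I \<omega> \<and> I \<omega> < \<infinity>" "\<omega> \<in> space M"
    have I: "I \<omega> = (\<integral>\<^sup>+u. ?w \<omega> u \<partial>lborel)"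
      by (simp add: I_def path_functional_def)
    show "min (I \<omega>) (ennreal a) = (\<integral>\<^sup>+s. ?w \<omega> s * indicator {..ennreal a}
        (\<integral>\<^sup>+u. ?w \<omega> u * indicator {s..} u \<partial>lborel) \<partial>lborel)"
      using \<omega> \<open>0 < a\<close> unfolding I by (subst nn_integral_tail_le) auto
  qed
  also have "\<dots> = (\<integral>\<^sup>+s. \<integral>\<^sup>+\<omega>. ?w \<omega> s * indicator {..ennreal a}
        (\<integral>\<^sup>+u. ?w \<omega> u * indicator {s..} u \<partial>lborel) \<partial>M \<partial>lborel)"
  proof (rule P.Fubini'[symmetric])
    have "(\<lambda>(p, u). ?w (fst p) u * of_bool (snd p \<le> u)) \<in> borel_measurable ((M \<Otimes>\<^sub>M lborel) \<Otimes>\<^sub>M lborel)"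
      by measurable
    then have [measurable]: "(\<lambda>(\<omega>, s). \<integral>\<^sup>+u. ?w \<omega> u * indicator {s..} u \<partial>lborel)
        \<in> borel_measurable (M \<Otimes>\<^sub>M lborel)"
      using lborel.borel_measurable_nn_integral[of "\<lambda>p u. ?w (fst p) u * of_bool (snd p \<le> u)" "M \<Otimes>\<^sub>M lborel"]
      by (simp add: case_prod_beta indicator_def)
    show "(\<lambda>(\<omega>, s). ?w \<omega> s * indicator {..ennreal a} (\<integral>\<^sup>+u. ?w \<omega> u * indicator {s..} u \<partial>lborel))
        \<in> borel_measurable (M \<Otimes>\<^sub>M lborel)"
      by measurable
  qed
  also have "\<dots> = (\<integral>\<^sup>+s. \<integral>\<^sup>+\<omega>. of_bool (A \<omega> s) * ?h (?rv \<omega> s) \<partial>M \<partial>lborel)"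
  proof (rule nn_integral_cong)
    fix s
    show "(\<integral>\<^sup>+\<omega>. ?w \<omega> s * indicator {..ennreal a}
          (\<integral>\<^sup>+u. ?w \<omega> u * indicator {s..} u \<partial>lborel) \<partial>M) =
        (\<integral>\<^sup>+\<omega>. of_bool (A \<omega> s) * ?h (?rv \<omega> s) \<partial>M)"
      by (cases "0 \<le> s") (simp_all add: expectation_at_fixed_time A_def, simp add: clock_rate_def)
  qed
  also have "\<dots> = (\<integral>\<^sup>+p. of_bool (A (fst p) (snd p)) * ?h (?rv (fst p) (snd p)) \<partial>(M \<Otimes>\<^sub>M lborel))"
    by (subst P.nn_integral_snd[symmetric]) simp_all
  also have "\<dots> = (\<integral>\<^sup>+p. \<integral>\<^sup>+t. of_bool (0 < t \<and> t \<le> a) * (of_bool (A (fst p) (snd p)) *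
      ennreal (k (t * exp (- ?rv (fst p) (snd p))))) \<partial>lborel \<partial>(M \<Otimes>\<^sub>M lborel))"
    by (intro nn_integral_cong, subst nn_integral_cmult[symmetric])
      (auto intro!: nn_integral_cong)
  also have "\<dots> = (\<integral>\<^sup>+t. \<integral>\<^sup>+p. of_bool (0 < t \<and> t \<le> a) * (of_bool (A (fst p) (snd p)) *
      ennreal (k (t * exp (- ?rv (fst p) (snd p))))) \<partial>(M \<Otimes>\<^sub>M lborel) \<partial>lborel)"
    by (rule PP.Fubini'[symmetric]) measurable
  also have "\<dots> = (\<integral>\<^sup>+t. of_bool (0 < t \<and> t \<le> a) *
      (\<integral>\<^sup>+y. ennreal (k (t * exp (- y))) \<partial>renewal_measure M (killed \<eta> \<zeta>) \<zeta>) \<partial>lborel)"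
    by (intro nn_integral_cong) (simp add: nn_integral_renewal_measure nn_integral_cmult A_def case_prod_beta)
  finally show ?thesis .
qed

lemma tail_eq_renewal_integral:
  "AE t in lborel. 0 < t \<longrightarrow> (\<integral>\<^sup>+s\<in>{t<..}. ennreal (k s) \<partial>lborel) =
    (\<integral>\<^sup>+y. ennreal (k (t * exp (- y))) \<partial>renewal_measure M (killed \<eta> \<zeta>) \<zeta>)"
proof -
  have "AE t in lborel. 0 < t \<longrightarrow> emeasure M {\<omega> \<in> space M. ennreal t < I \<omega>} =
      (\<integral>\<^sup>+y. ennreal (k (t * exp (- y))) \<partial>renewal_measure M (killed \<eta> \<zeta>) \<zeta>)"
  proof (rule AE_lborel_eq_if_integrals_atMost_eq)
    show "(\<lambda>t. emeasure M {\<omega> \<in> space M. ennreal t < I \<omega>}) \<in> borel_measurable borel"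
      by measurable
    fix a :: real
    assume a: "0 < a"
    show "(\<integral>\<^sup>+t. of_bool (0 < t \<and> t \<le> a) * emeasure M {\<omega> \<in> space M. ennreal t < I \<omega>} \<partial>lborel) =
        (\<integral>\<^sup>+t. of_bool (0 < t \<and> t \<le> a) *
          (\<integral>\<^sup>+y. ennreal (k (t * exp (- y))) \<partial>renewal_measure M (killed \<eta> \<zeta>) \<zeta>) \<partial>lborel)"
      using truncated_expectation_eq_tail[OF a] truncated_expectation_eq_renewal[OF a] by simp
    have "(\<integral>\<^sup>+\<omega>. min (I \<omega>) (ennreal a) \<partial>M) \<le> (\<integral>\<^sup>+\<omega>. ennreal a \<partial>M)"
      by (intro nn_integral_mono) simp
    also have "\<dots> < \<infinity>"
      by (simp add: emeasure_space_1)
    finally show "(\<integral>\<^sup>+t. of_bool (0 < t \<and> t \<le> a) *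
        emeasure M {\<omega> \<in> space M. ennreal t < I \<omega>} \<partial>lborel) < \<infinity>"
      by (simp add: truncated_expectation_eq_tail[OF a])
  qed measurable
  then show ?thesis
    by eventually_elim (simp add: emeasure_functional_greater)
qed

end

end

theorem theorem2p1:
  fixes M :: "'a measure" and \<eta> :: "real \<Rightarrow> 'a \<Rightarrow> real" and \<zeta> :: "'a \<Rightarrow> ennreal" and q :: real
    and \<xi> :: "real \<Rightarrow> 'a \<Rightarrow> ereal" and k :: "real \<Rightarrow> real"
  assumes "killed_levy_process M \<eta> \<zeta> q"
    and "\<xi> = killed \<eta> \<zeta>"
    and "q = 0 \<Longrightarrow> AE \<omega> in M. ((\<lambda>t. \<xi> t \<omega>) \<longlongrightarrow> - \<infinity>) at_top"
    and "has_probability_density M (exponential_functional \<xi> \<zeta>) k"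
  shows "AE t in lborel. 0 < t \<longrightarrow>
           (\<integral>\<^sup>+s\<in>{t<..}. ennreal (k s) \<partial>lborel) =
           (\<integral>\<^sup>+y. ennreal (k (t * exp (- y))) \<partial>renewal_measure M \<xi> \<zeta>)"
proof -
  interpret killed_levy_process M \<eta> \<zeta> q
    by fact
  show ?thesis
    using assms(4) unfolding \<open>\<xi> = killed \<eta> \<zeta>\<close> by (rule tail_eq_renewal_integral)
qed

end
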